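(* Every separable bicomplex Hilbert space $M$ is isometrically isomorphic to the bicomplex Hilbert space $l^2_2$; that is, there exists a bijective $\mathbb{M}(2)$-linear map $T:M\to l^2_2$ with $\|T(|\phi\rangle)\|_2=\|\,|\phi\rangle\|$ for all $|\phi\rangle\in M$.
   Context: Bicomplex numbers: $\mathbb{M}(2)=\{z_1+z_2\mathbf{i_2} : z_1,z_2\in\mathbb{C}(\mathbf{i_1})\}$, where $\mathbf{i_1},\mathbf{i_2}$ are independent commuting imaginary units with $\mathbf{i_1}^2=\mathbf{i_2}^2=-1$, and $\mathbb{C}(\mathbf{i_1})=\{x+y\mathbf{i_1}: x,y\in\mathbb{R}\}\cong\mathbb{C}$. Put $\mathbf{j}=\mathbf{i_1}\mathbf{i_2}$ (so $\mathbf{j}^2=1$). $\mathbb{M}(2)$ is a commutative ring. For $w=z_1+z_2\mathbf{i_2}$: the conjugate is $w^{\dagger_3}=\bar z_1-\bar z_2\mathbf{i_2}$ (bar is conjugation in $\mathbb{C}(\mathbf{i_1})$), and the Euclidean norm is $|w|=\sqrt{|z_1|^2+|z_2|^2}$. Put $\mathbf{e_1}=(1+\mathbf{j})/2$, $\mathbf{e_2}=(1-\mathbf{j})/2$; these are idempotents with $\mathbf{e_1}+\mathbf{e_2}=1$, $\mathbf{e_1}\mathbf{e_2}=0$. Every $w$ is uniquely $w=P_1(w)\mathbf{e_1}+P_2(w)\mathbf{e_2}$ with $P_1(w)=z_1-z_2\mathbf{i_1}$, $P_2(w)=z_1+z_2\mathbf{i_1}$ in $\mathbb{C}(\mathbf{i_1})$.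 Let $\mathbb{D}_+=\{x\mathbf{e_1}+y\mathbf{e_2}: x,y\ge 0 \text{ real}\}$. Scalar product: for an $\mathbb{M}(2)$-module $M$ (elements are written $|\psi\rangle$), a bicomplex scalar product is a map $(\cdot,\cdot):M\times M\to\mathbb{M}(2)$ that is additive and $\mathbb{M}(2)$-homogeneous in the second argument, satisfies $(|\psi\rangle,|\phi\rangle)=(|\phi\rangle,|\psi\rangle)^{\dagger_3}$, satisfies $(|\psi\rangle,|\psi\rangle)=0\Leftrightarrow|\psi\rangle=0$, and is hyperbolic positive: $(|\psi\rangle,|\psi\rangle)\in\mathbb{D}_+$ for all $|\psi\rangle$. The induced norm is $\|\,|\phi\rangle\|=\frac{1}{\sqrt2}\sqrt{P_1((|\phi\rangle,|\phi\rangle))+P_2((|\phi\rangle,|\phi\rangle))}$. A bicomplex Hilbert space is an $\mathbb{M}(2)$-module with a bicomplex scalar product that is complete for the induced norm. Standing convention: bicomplex Hilbert spaces are infinite dimensional, meaning that for every $n$ they contain $n$ elements that are linearly independent over $\mathbb{M}(2)$. Separable means having a countable dense subset in the norm topology. $l^2_2$ is the $\mathbb{M}(2)$-module (componentwise operations) of all sequences $\{w_l\}_{l\ge1}$ of bicomplex numbers with $\sum_{l=1}^\infty|w_l|^2<\infty$, with norm $\|\{w_l\}\|_2=\big(\sum_{l=1}^\infty|w_l|^2\big)^{1/2}$, which is the norm induced by the bicomplex scalar product $(\{w_l\},\{w_l'\})=\mathbf{e_1}\sum_l\overline{P_1(w_l)}P_1(w_l')+\mathbf{e_2}\sum_l\overline{P_2(w_l)}P_2(w_l')$.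 *)

theory Defs
  imports "HOL-Analysis.Analysis"
begin

section \<open>Bicomplex numbers\<close>

text \<open>\<open>Bicomplex z\<^sub>1 z\<^sub>2\<close> stands for \<open>z\<^sub>1 + z\<^sub>2 i\<^sub>2\<close>; the type \<^typ>\<open>complex\<close> plays the role of \<open>C(i\<^sub>1)\<close>.\<close>

datatype bicomplex = Bicomplex (bc_fst: complex) (bc_snd: complex)

lemma bicomplex_eqI: "bc_fst v = bc_fst w \<Longrightarrow> bc_snd v = bc_snd w \<Longrightarrow> v = w"
  by (cases v; cases w) simp

instantiation bicomplex :: comm_ring_1
begin

definition "0 = Bicomplex 0 0"
definition "1 = Bicomplex 1 0"
definition "v + w = Bicomplex (bc_fst v + bc_fst w) (bc_snd v + bc_snd w)"
definition "v - w = Bicomplex (bc_fst v - bc_fst w) (bc_snd v - bc_snd w)"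
definition "- w = Bicomplex (- bc_fst w) (- bc_snd w)"
definition "v * w = Bicomplex (bc_fst v * bc_fst w - bc_snd v * bc_snd w)
                              (bc_fst v * bc_snd w + bc_snd v * bc_fst w)"

instance
  by standard
    (simp_all add: zero_bicomplex_def one_bicomplex_def plus_bicomplex_def minus_bicomplex_def
      uminus_bicomplex_def times_bicomplex_def algebra_simps)

end

lemmas bicomplex_defs = zero_bicomplex_def one_bicomplex_def plus_bicomplex_def
  minus_bicomplex_def uminus_bicomplex_def times_bicomplex_def

definition bc_of_complex :: "complex \<Rightarrow> bicomplex" where
  "bc_of_complex z = Bicomplex z 0"

definition bc_i1 :: bicomplex where "bc_i1 = bc_of_complex \<i>"
definition bc_i2 :: bicomplex where "bc_i2 = Bicomplex 0 1"
definition bc_j :: bicomplex where "bc_j = bc_i1 * bc_i2"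
definition bc_e1 :: bicomplex where "bc_e1 = bc_of_complex (1/2) * (1 + bc_j)"
definition bc_e2 :: bicomplex where "bc_e2 = bc_of_complex (1/2) * (1 - bc_j)"

definition bc_P1 :: "bicomplex \<Rightarrow> complex" where
  "bc_P1 w = bc_fst w - bc_snd w * \<i>"

definition bc_P2 :: "bicomplex \<Rightarrow> complex" where
  "bc_P2 w = bc_fst w + bc_snd w * \<i>"

text \<open>The conjugation \<open>\<dagger>\<^sub>3\<close>.\<close>

definition bc_cnj3 :: "bicomplex \<Rightarrow> bicomplex" where
  "bc_cnj3 w = Bicomplex (cnj (bc_fst w)) (- cnj (bc_snd w))"

definition bc_norm :: "bicomplex \<Rightarrow> real" where
  "bc_norm w = sqrt ((cmod (bc_fst w))\<^sup>2 + (cmod (bc_snd w))\<^sup>2)"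

definition bc_D_plus :: "bicomplex set" where
  "bc_D_plus = {bc_of_complex (of_real x) * bc_e1 + bc_of_complex (of_real y) * bc_e2 |
                  x y :: real. 0 \<le> x \<and> 0 \<le> y}"

lemma bc_i2_square: "bc_i2 * bc_i2 = - 1"
  by (simp add: bc_i2_def bicomplex_defs)

lemma bc_i1_square: "bc_i1 * bc_i1 = - 1"
  by (simp add: bc_i1_def bc_of_complex_def bicomplex_defs)

lemma bicomplex_decomp: "w = bc_of_complex (bc_fst w) + bc_of_complex (bc_snd w) * bc_i2"
  by (rule bicomplex_eqI) (simp_all add: bc_of_complex_def bc_i2_def bicomplex_defs)

lemma bc_e1_explicit: "bc_e1 = Bicomplex (1/2) (\<i>/2)"
  by (simp add: bc_e1_def bc_j_def bc_i1_def bc_i2_def bc_of_complex_def bicomplex_defs)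

lemma bc_e2_explicit: "bc_e2 = Bicomplex (1/2) (- \<i>/2)"
  by (simp add: bc_e2_def bc_j_def bc_i1_def bc_i2_def bc_of_complex_def bicomplex_defs)

lemma bc_P_eqI:
  assumes "bc_P1 v = bc_P1 w" "bc_P2 v = bc_P2 w"
  shows "v = w"
proof (rule bicomplex_eqI)
  have "bc_fst u = (bc_P1 u + bc_P2 u) / 2" for u
    by (simp add: bc_P1_def bc_P2_def)
  then show 1: "bc_fst v = bc_fst w"
    by (metis assms)
  show "bc_snd v = bc_snd w"
    using assms(1) by (simp add: bc_P1_def 1)
qed

lemma bc_P_simps [simp]:
  "bc_P1 0 = 0" "bc_P1 1 = 1" "bc_P1 (v + w) = bc_P1 v + bc_P1 w" "bc_P1 (v - w) = bc_P1 v - bc_P1 w"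
  "bc_P1 (- w) = - bc_P1 w" "bc_P1 (v * w) = bc_P1 v * bc_P1 w"
  "bc_P2 0 = 0" "bc_P2 1 = 1" "bc_P2 (v + w) = bc_P2 v + bc_P2 w" "bc_P2 (v - w) = bc_P2 v - bc_P2 w"
  "bc_P2 (- w) = - bc_P2 w" "bc_P2 (v * w) = bc_P2 v * bc_P2 w"
  "bc_P1 (bc_of_complex z) = z" "bc_P2 (bc_of_complex z) = z"
  "bc_P1 bc_e1 = 1" "bc_P1 bc_e2 = 0" "bc_P2 bc_e1 = 0" "bc_P2 bc_e2 = 1"
  "bc_P1 (bc_cnj3 w) = cnj (bc_P1 w)" "bc_P2 (bc_cnj3 w) = cnj (bc_P2 w)"
  by (simp_all add: bc_P1_def bc_P2_def bicomplex_defs bc_of_complex_def bc_e1_explicit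
      bc_e2_explicit bc_cnj3_def algebra_simps)

lemma bc_idempotent_decomp: "w = bc_of_complex (bc_P1 w) * bc_e1 + bc_of_complex (bc_P2 w) * bc_e2"
  by (rule bc_P_eqI) simp_all

lemma bc_D_plus_iff:
  "w \<in> bc_D_plus \<longleftrightarrow> Im (bc_P1 w) = 0 \<and> Im (bc_P2 w) = 0 \<and> 0 \<le> Re (bc_P1 w) \<and> 0 \<le> Re (bc_P2 w)"
proof
  assume r: "Im (bc_P1 w) = 0 \<and> Im (bc_P2 w) = 0 \<and> 0 \<le> Re (bc_P1 w) \<and> 0 \<le> Re (bc_P2 w)"
  then have "bc_P1 w = of_real (Re (bc_P1 w))" "bc_P2 w = of_real (Re (bc_P2 w))"
    by (simp_all add: complex_eq_iff)
  then have "w = bc_of_complex (of_real (Re (bc_P1 w))) * bc_e1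
               + bc_of_complex (of_real (Re (bc_P2 w))) * bc_e2"
    using bc_idempotent_decomp[of w] by simp
  then show "w \<in> bc_D_plus"
    using r unfolding bc_D_plus_def by blast
qed (auto simp: bc_D_plus_def)

lemma bc_norm_nonneg [simp]: "0 \<le> bc_norm w"
  by (simp add: bc_norm_def)

lemma bc_norm_square: "(bc_norm w)\<^sup>2 = ((cmod (bc_P1 w))\<^sup>2 + (cmod (bc_P2 w))\<^sup>2) / 2"
  by (simp add: bc_norm_def bc_P1_def bc_P2_def cmod_power2) (simp add: power2_eq_square algebra_simps)


section \<open>Bicomplex scalar products and Hilbert spaces\<close>

text \<open>For a scalar product the argument of \<^const>\<open>Re\<close> is a nonnegative real, by hyperbolic
  positivity.\<close>

definition sp_norm :: "('m \<Rightarrow> 'm \<Rightarrow> bicomplex) \<Rightarrow> 'm \<Rightarrow> real" where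
  "sp_norm sp x = 1 / sqrt 2 * sqrt (Re (bc_P1 (sp x x) + bc_P2 (sp x x)))"

definition sp_dist :: "('m \<Rightarrow> 'm \<Rightarrow> bicomplex) \<Rightarrow> 'm::ab_group_add \<Rightarrow> 'm \<Rightarrow> real" where
  "sp_dist sp x y = sp_norm sp (x - y)"

locale bicomplex_scalar_product = module scale
  for scale :: "bicomplex \<Rightarrow> 'm::ab_group_add \<Rightarrow> 'm" +
  fixes sp :: "'m \<Rightarrow> 'm \<Rightarrow> bicomplex"
  assumes sp_add_right: "sp x (y + z) = sp x y + sp x z"
    and sp_scale_right: "sp x (scale c y) = c * sp x y"
    and sp_cnj: "sp x y = bc_cnj3 (sp y x)"
    and sp_definite: "sp x x = 0 \<longleftrightarrow> x = 0"
    and sp_positive: "sp x x \<in> bc_D_plus"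
begin

text \<open>The real inner product inducing \<^const>\<open>sp_norm\<close>; used to show that \<^const>\<open>sp_dist\<close> is a
  metric.\<close>

definition rsp :: "'m \<Rightarrow> 'm \<Rightarrow> real" where
  "rsp x y = Re (bc_P1 (sp x y) + bc_P2 (sp x y)) / 2"

lemma rsp_sym: "rsp x y = rsp y x"
  by (simp add: rsp_def sp_cnj[of x y])

lemma rsp_add_right: "rsp x (y + z) = rsp x y + rsp x z"
  by (simp add: rsp_def sp_add_right add_divide_distrib)

lemma rsp_add_left: "rsp (x + y) z = rsp x z + rsp y z"
  using rsp_add_right rsp_sym by metis

lemma rsp_scale_right: "rsp x (scale (bc_of_complex (of_real t)) y) = t * rsp x y"
  by (simp add: rsp_def sp_scale_right algebra_simps)

lemma rsp_scale_left: "rsp (scale (bc_of_complex (of_real t)) x) y = t * rsp x y"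
  using rsp_scale_right rsp_sym by metis

lemma rsp_minus_right: "rsp x (- y) = - rsp x y"
  using rsp_add_right[of x y "- y"] rsp_add_right[of x 0 0] by simp

lemma rsp_minus_left: "rsp (- x) y = - rsp x y"
  using rsp_minus_right rsp_sym by metis

lemma rsp_nonneg: "0 \<le> rsp x x"
  using sp_positive[of x] by (simp add: rsp_def bc_D_plus_iff)

lemma rsp_eq_0_iff: "rsp x x = 0 \<longleftrightarrow> x = 0"
proof
  assume "rsp x x = 0"
  then have "sp x x = 0"
    using sp_positive[of x] by (intro bc_P_eqI) (auto simp: rsp_def bc_D_plus_iff complex_eq_iff)
  then show "x = 0" by (simp add: sp_definite)
next
  assume "x = 0"
  then have "sp x x = 0" by (simp add: sp_definite)
  then show "rsp x x = 0" by (simp add: rsp_def)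
qed

lemma sp_norm_eq: "sp_norm sp x = sqrt (rsp x x)"
  by (simp add: sp_norm_def rsp_def real_sqrt_divide)

lemma rsp_le: "rsp x y \<le> sp_norm sp x * sp_norm sp y"
proof -
  define a b c where "a = rsp x x" and "b = rsp x y" and "c = rsp y y"
  have q: "0 \<le> a + 2 * t * b + t\<^sup>2 * c" for t
  proof -
    let ?z = "x + scale (bc_of_complex (of_real t)) y"
    have "rsp ?z ?z = a + 2 * t * b + t\<^sup>2 * c"
      by (simp add: rsp_add_left rsp_add_right rsp_scale_left rsp_scale_right a_def b_def c_def
          rsp_sym[of y x] power2_eq_square algebra_simps)
    with rsp_nonneg[of ?z] show ?thesis by simp
  qed
  have "b\<^sup>2 \<le> a * c"
  proof (cases "c = 0")
    case True
    then have "y = 0" using rsp_eq_0_iff c_def by simp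
    then have "b = 0" using rsp_add_right[of x 0 0] by (simp add: b_def)
    then show ?thesis using True by simp
  next
    case False
    then have c: "0 < c" using rsp_nonneg[of y] by (simp add: c_def)
    have "0 \<le> a + 2 * (- b / c) * b + (- b / c)\<^sup>2 * c" by (rule q)
    also have "\<dots> = (a * c - b\<^sup>2) / c" using c by (simp add: field_simps power2_eq_square)
    finally show ?thesis using c by (simp add: zero_le_divide_iff)
  qed
  then have "\<bar>b\<bar> \<le> sqrt (a * c)" by (metis real_sqrt_abs real_sqrt_le_mono)
  then show ?thesis by (simp add: sp_norm_eq a_def b_def c_def real_sqrt_mult)
qed

lemma sp_norm_triangle: "sp_norm sp (x + y) \<le> sp_norm sp x + sp_norm sp y"
proof (rule power2_le_imp_le)
  have sq: "(sp_norm sp z)\<^sup>2 = rsp z z" for z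
    using rsp_nonneg by (simp add: sp_norm_eq)
  have "(sp_norm sp (x + y))\<^sup>2 = rsp x x + 2 * rsp x y + rsp y y"
    by (simp add: sq rsp_add_left rsp_add_right rsp_sym[of y x])
  also have "\<dots> \<le> (sp_norm sp x + sp_norm sp y)\<^sup>2"
    using rsp_le[of x y] by (simp add: power2_sum sq)
  finally show "(sp_norm sp (x + y))\<^sup>2 \<le> (sp_norm sp x + sp_norm sp y)\<^sup>2" .
  show "0 \<le> sp_norm sp x + sp_norm sp y" using rsp_nonneg by (simp add: sp_norm_eq)
qed

sublocale Metric_space UNIV "sp_dist sp"
proof
  fix x y z :: 'm
  show "0 \<le> sp_dist sp x y" using rsp_nonneg by (simp add: sp_dist_def sp_norm_eq)
  show "sp_dist sp x y = 0 \<longleftrightarrow> x = y" by (simp add: sp_dist_def sp_norm_eq rsp_eq_0_iff)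
  have "rsp (- (x - y)) (- (x - y)) = rsp (x - y) (x - y)"
    by (simp only: rsp_minus_left rsp_minus_right minus_minus)
  then show "sp_dist sp x y = sp_dist sp y x" by (simp add: sp_dist_def sp_norm_eq)
  show "sp_dist sp x z \<le> sp_dist sp x y + sp_dist sp y z"
    using sp_norm_triangle[of "x - y" "y - z"] by (simp add: sp_dist_def)
qed

end

locale bicomplex_hilbert_space = bicomplex_scalar_product +
  assumes complete: mcomplete


section \<open>The space \<open>l\<^sup>2\<^sub>2\<close>\<close>

lemma summable_bc_norm_square_iff:
  "summable (\<lambda>l. (bc_norm (w l))\<^sup>2) \<longleftrightarrow>
   summable (\<lambda>l. (cmod (bc_P1 (w l)))\<^sup>2) \<and> summable (\<lambda>l. (cmod (bc_P2 (w l)))\<^sup>2)"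
proof
  assume s: "summable (\<lambda>l. (bc_norm (w l))\<^sup>2)"
  have "summable (\<lambda>l. 2 * (bc_norm (w l))\<^sup>2)" by (rule summable_mult[OF s])
  then show "summable (\<lambda>l. (cmod (bc_P1 (w l)))\<^sup>2) \<and> summable (\<lambda>l. (cmod (bc_P2 (w l)))\<^sup>2)"
    by (intro conjI; elim summable_comparison_test'[where N = 0]) (simp_all add: bc_norm_square)
next
  assume "summable (\<lambda>l. (cmod (bc_P1 (w l)))\<^sup>2) \<and> summable (\<lambda>l. (cmod (bc_P2 (w l)))\<^sup>2)"
  then show "summable (\<lambda>l. (bc_norm (w l))\<^sup>2)"
    unfolding bc_norm_square by (intro summable_divide summable_add) auto
qed

lemma summable_cmod_square_add:
  assumes "summable (\<lambda>l::nat. (cmod (f l))\<^sup>2)" "summable (\<lambda>l. (cmod (g l))\<^sup>2)"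
  shows "summable (\<lambda>l. (cmod (f l + g l))\<^sup>2)"
proof (rule summable_comparison_test'[where N = 0])
  show "summable (\<lambda>l. 2 * (cmod (f l))\<^sup>2 + 2 * (cmod (g l))\<^sup>2)"
    by (intro summable_add summable_mult assms)
  fix l
  have "(cmod (f l + g l))\<^sup>2 \<le> (cmod (f l) + cmod (g l))\<^sup>2"
    by (intro power_mono norm_triangle_ineq) simp
  also have "\<dots> \<le> 2 * (cmod (f l))\<^sup>2 + 2 * (cmod (g l))\<^sup>2"
    using sum_squares_bound[of "cmod (f l)" "cmod (g l)"] by (simp add: power2_sum)
  finally show "norm ((cmod (f l + g l))\<^sup>2) \<le> 2 * (cmod (f l))\<^sup>2 + 2 * (cmod (g l))\<^sup>2" by simp
qed

lemma summable_cmod_square_diff: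
  assumes "summable (\<lambda>l::nat. (cmod (f l))\<^sup>2)" "summable (\<lambda>l. (cmod (g l))\<^sup>2)"
  shows "summable (\<lambda>l. (cmod (f l - g l))\<^sup>2)"
  using summable_cmod_square_add[of f "\<lambda>l. - g l"] assms by simp

lemma summable_cnj_mult:
  assumes "summable (\<lambda>l::nat. (cmod (f l))\<^sup>2)" "summable (\<lambda>l. (cmod (g l))\<^sup>2)"
  shows "summable (\<lambda>l. cnj (f l) * g l)"
proof (rule summable_comparison_test'[where N = 0])
  show "summable (\<lambda>l. (cmod (f l))\<^sup>2 + (cmod (g l))\<^sup>2)"
    by (intro summable_add assms)
  fix l
  show "norm (cnj (f l) * g l) \<le> (cmod (f l))\<^sup>2 + (cmod (g l))\<^sup>2"
    using sum_squares_bound[of "cmod (f l)" "cmod (g l)"]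
      mult_nonneg_nonneg[OF norm_ge_zero[of "f l"] norm_ge_zero[of "g l"]]
    unfolding norm_mult complex_mod_cnj by linarith
qed

text \<open>Sequences are indexed from 0.\<close>

typedef l22 = "{w :: nat \<Rightarrow> bicomplex. summable (\<lambda>l. (bc_norm (w l))\<^sup>2)}"
  morphisms l22_seq Abs_l22
  by (rule exI[of _ "\<lambda>_. 0"]) (simp add: bc_norm_def zero_bicomplex_def)

setup_lifting type_definition_l22

instantiation l22 :: ab_group_add
begin

lift_definition zero_l22 :: l22 is "\<lambda>_. 0"
  by (simp add: bc_norm_def zero_bicomplex_def)

lift_definition plus_l22 :: "l22 \<Rightarrow> l22 \<Rightarrow> l22" is "\<lambda>v w l. v l + w l"
  by (simp add: summable_bc_norm_square_iff summable_cmod_square_add)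

lift_definition uminus_l22 :: "l22 \<Rightarrow> l22" is "\<lambda>w l. - w l"
  by (simp add: summable_bc_norm_square_iff)

lift_definition minus_l22 :: "l22 \<Rightarrow> l22 \<Rightarrow> l22" is "\<lambda>v w l. v l - w l"
  by (simp add: summable_bc_norm_square_iff summable_cmod_square_diff)

instance
  by standard (transfer; simp add: algebra_simps)+

end

lift_definition l22_scale :: "bicomplex \<Rightarrow> l22 \<Rightarrow> l22" is "\<lambda>c w l. c * w l"
  by (simp add: summable_bc_norm_square_iff norm_mult power_mult_distrib summable_mult)

definition l22_norm :: "l22 \<Rightarrow> real" where
  "l22_norm w = sqrt (\<Sum>l. (bc_norm (l22_seq w l))\<^sup>2)"

definition l22_sp :: "l22 \<Rightarrow> l22 \<Rightarrow> bicomplex" where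
  "l22_sp v w =
     bc_e1 * bc_of_complex (\<Sum>l. cnj (bc_P1 (l22_seq v l)) * bc_P1 (l22_seq w l)) +
     bc_e2 * bc_of_complex (\<Sum>l. cnj (bc_P2 (l22_seq v l)) * bc_P2 (l22_seq w l))"

lemma l22_summable:
  "summable (\<lambda>l. (bc_norm (l22_seq w l))\<^sup>2)"
  "summable (\<lambda>l. (cmod (bc_P1 (l22_seq w l)))\<^sup>2)"
  "summable (\<lambda>l. (cmod (bc_P2 (l22_seq w l)))\<^sup>2)"
  using l22_seq[of w] by (auto simp: summable_bc_norm_square_iff)

lemma l22_sp_P:
  "bc_P1 (l22_sp v w) = (\<Sum>l. cnj (bc_P1 (l22_seq v l)) * bc_P1 (l22_seq w l))"
  "bc_P2 (l22_sp v w) = (\<Sum>l. cnj (bc_P2 (l22_seq v l)) * bc_P2 (l22_seq w l))"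
  by (simp_all add: l22_sp_def)

lemma l22_sp_self:
  "bc_P1 (l22_sp w w) = of_real (\<Sum>l. (cmod (bc_P1 (l22_seq w l)))\<^sup>2)"
  "bc_P2 (l22_sp w w) = of_real (\<Sum>l. (cmod (bc_P2 (l22_seq w l)))\<^sup>2)"
proof -
  have eq: "cnj z * z = of_real ((cmod z)\<^sup>2)" for z
    by (simp only: complex_norm_square mult.commute)
  show "bc_P1 (l22_sp w w) = of_real (\<Sum>l. (cmod (bc_P1 (l22_seq w l)))\<^sup>2)"
    unfolding l22_sp_P eq by (rule suminf_of_real[OF l22_summable(2), symmetric])
  show "bc_P2 (l22_sp w w) = of_real (\<Sum>l. (cmod (bc_P2 (l22_seq w l)))\<^sup>2)"
    unfolding l22_sp_P eq by (rule suminf_of_real[OF l22_summable(3), symmetric])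
qed

interpretation l22: bicomplex_scalar_product l22_scale l22_sp
proof
  fix c d and u v w :: l22
  show "l22_scale c (v + w) = l22_scale c v + l22_scale c w"
    by transfer (simp add: algebra_simps)
  show "l22_scale (c + d) w = l22_scale c w + l22_scale d w"
    by transfer (simp add: algebra_simps)
  show "l22_scale c (l22_scale d w) = l22_scale (c * d) w"
    by transfer (simp add: algebra_simps)
  show "l22_scale 1 w = w"
    by transfer simp
  note s = summable_cnj_mult[OF l22_summable(2) l22_summable(2)]
    summable_cnj_mult[OF l22_summable(3) l22_summable(3)]
  show "l22_sp u (v + w) = l22_sp u v + l22_sp u w"
    by (rule bc_P_eqI) (simp_all add: l22_sp_P plus_l22.rep_eq distrib_left
        suminf_add[symmetric] s)
  show "l22_sp v (l22_scale c w) = c * l22_sp v w"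
    by (rule bc_P_eqI)
      (simp_all add: l22_sp_P l22_scale.rep_eq mult.left_commute[of _ "bc_P1 c"] mult.left_commute[of _ "bc_P2 c"]
        suminf_mult s)
  have cnj_suminf: "cnj (\<Sum>l. f l) = (\<Sum>l. cnj (f l))" if "summable f" for f :: "nat \<Rightarrow> complex"
    by (rule bounded_linear.suminf[OF bounded_linear_cnj that])
  show "l22_sp v w = bc_cnj3 (l22_sp w v)"
    by (rule bc_P_eqI; simp add: l22_sp_P cnj_suminf s; simp add: mult.commute)
  show "l22_sp w w = 0 \<longleftrightarrow> w = 0"
  proof
    assume "l22_sp w w = 0"
    then have "bc_P1 (l22_sp w w) = 0" "bc_P2 (l22_sp w w) = 0" by simp_all
    then have "bc_P1 (l22_seq w l) = 0" "bc_P2 (l22_seq w l) = 0" for l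
      unfolding l22_sp_self of_real_eq_0_iff
      using suminf_eq_zero_iff[OF l22_summable(2)] suminf_eq_zero_iff[OF l22_summable(3)]
      by simp_all
    then have "l22_seq w l = 0" for l by (intro bc_P_eqI) simp_all
    then have "l22_seq w = l22_seq 0" by (simp add: fun_eq_iff zero_l22.rep_eq)
    then show "w = 0" by (simp add: l22_seq_inject)
  next
    assume "w = 0"
    then show "l22_sp w w = 0" by (intro bc_P_eqI) (simp_all add: l22_sp_P zero_l22.rep_eq)
  qed
  show "l22_sp w w \<in> bc_D_plus"
    by (simp add: bc_D_plus_iff l22_sp_self suminf_nonneg l22_summable)
qed

lemma l22_norm_eq_sp_norm: "l22_norm w = sp_norm l22_sp w"
proof -
  have "(\<lambda>l. (bc_norm (l22_seq w l))\<^sup>2) sums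
        (((\<Sum>l. (cmod (bc_P1 (l22_seq w l)))\<^sup>2) + (\<Sum>l. (cmod (bc_P2 (l22_seq w l)))\<^sup>2)) / 2)"
    unfolding bc_norm_square by (intro sums_divide sums_add summable_sums l22_summable)
  then have "l22_norm w = sqrt
        (((\<Sum>l. (cmod (bc_P1 (l22_seq w l)))\<^sup>2) + (\<Sum>l. (cmod (bc_P2 (l22_seq w l)))\<^sup>2)) / 2)"
    unfolding l22_norm_def by (simp only: sums_unique[symmetric])
  then show ?thesis
    by (simp add: sp_norm_def l22_sp_self real_sqrt_divide)
qed

interpretation l22: bicomplex_hilbert_space l22_scale l22_sp
proof
  show "l22.mcomplete"
    unfolding l22.mcomplete_def
  proof (intro allI impI)
    fix \<sigma> :: "nat \<Rightarrow> l22"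
    assume "l22.MCauchy \<sigma>"
    then have cauchy: "\<exists>N. \<forall>n m. N \<le> n \<longrightarrow> N \<le> m \<longrightarrow> l22_norm (\<sigma> n - \<sigma> m) < \<epsilon>" if "\<epsilon> > 0" for \<epsilon>
      using that by (auto simp: l22.MCauchy_def sp_dist_def l22_norm_eq_sp_norm)
    have partial: "(\<Sum>l<K. (bc_norm (l22_seq v l))\<^sup>2) \<le> (l22_norm v)\<^sup>2" for K v
      by (simp add: l22_norm_def suminf_nonneg l22_summable sum_le_suminf)
    have coord: "(bc_norm (l22_seq v l))\<^sup>2 \<le> (l22_norm v)\<^sup>2" for v l
      using partial[of v "Suc l"] sum_nonneg[of "{..<l}" "\<lambda>l. (bc_norm (l22_seq v l))\<^sup>2"] by simp
    have coordP: "cmod (bc_P1 (l22_seq v l)) \<le> 2 * l22_norm v"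
      "cmod (bc_P2 (l22_seq v l)) \<le> 2 * l22_norm v" for v l
    proof -
      have nn: "0 \<le> l22_norm v" by (simp add: l22_norm_def suminf_nonneg l22_summable)
      have "(cmod (bc_P1 (l22_seq v l)))\<^sup>2 + (cmod (bc_P2 (l22_seq v l)))\<^sup>2 \<le> 2 * (l22_norm v)\<^sup>2"
        using coord[of v l] by (simp add: bc_norm_square)
      moreover have "(2 * l22_norm v)\<^sup>2 = 4 * (l22_norm v)\<^sup>2" by (simp add: power_mult_distrib)
      moreover have "0 \<le> (l22_norm v)\<^sup>2" "0 \<le> (cmod (bc_P1 (l22_seq v l)))\<^sup>2"
        "0 \<le> (cmod (bc_P2 (l22_seq v l)))\<^sup>2" by simp_all
      ultimately have "(cmod (bc_P1 (l22_seq v l)))\<^sup>2 \<le> (2 * l22_norm v)\<^sup>2"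
        "(cmod (bc_P2 (l22_seq v l)))\<^sup>2 \<le> (2 * l22_norm v)\<^sup>2" by linarith+
      then show "cmod (bc_P1 (l22_seq v l)) \<le> 2 * l22_norm v"
        "cmod (bc_P2 (l22_seq v l)) \<le> 2 * l22_norm v"
        using nn by (auto intro: power2_le_imp_le)
    qed
    have conv: "convergent (\<lambda>n. P (l22_seq (\<sigma> n) l))"
      if P: "\<And>v w. P (v - w) = P v - P w" "\<And>v. cmod (P (l22_seq v l)) \<le> 2 * l22_norm v"
      for P :: "bicomplex \<Rightarrow> complex" and l
    proof (rule Cauchy_convergent, rule metric_CauchyI)
      fix \<epsilon> :: real assume "\<epsilon> > 0"
      then obtain N where N: "\<And>n m. N \<le> n \<Longrightarrow> N \<le> m \<Longrightarrow> l22_norm (\<sigma> n - \<sigma> m) < \<epsilon> / 2"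
        using cauchy[of "\<epsilon> / 2"] by auto
      have "dist (P (l22_seq (\<sigma> m) l)) (P (l22_seq (\<sigma> n) l)) < \<epsilon>" if "N \<le> m" "N \<le> n" for m n
        using N[OF that] P(2)[of "\<sigma> m - \<sigma> n"] by (simp add: dist_norm P(1) minus_l22.rep_eq)
      then show "\<exists>N. \<forall>m\<ge>N. \<forall>n\<ge>N. dist (P (l22_seq (\<sigma> m) l)) (P (l22_seq (\<sigma> n) l)) < \<epsilon>"
        by blast
    qed
    have "\<forall>l. \<exists>p. (\<lambda>n. bc_P1 (l22_seq (\<sigma> n) l)) \<longlonglongrightarrow> p"
      using conv[of bc_P1] coordP by (auto simp: convergent_def)
    then obtain p where p: "\<And>l. (\<lambda>n. bc_P1 (l22_seq (\<sigma> n) l)) \<longlonglongrightarrow> p l"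
      by metis
    have "\<forall>l. \<exists>q. (\<lambda>n. bc_P2 (l22_seq (\<sigma> n) l)) \<longlonglongrightarrow> q"
      using conv[of bc_P2] coordP by (auto simp: convergent_def)
    then obtain q where q: "\<And>l. (\<lambda>n. bc_P2 (l22_seq (\<sigma> n) l)) \<longlonglongrightarrow> q l"
      by metis
    define w where "w l = bc_of_complex (p l) * bc_e1 + bc_of_complex (q l) * bc_e2" for l
    have w: "bc_P1 (w l) = p l" "bc_P2 (w l) = q l" for l
      by (simp_all add: w_def)
    have lim: "(\<Sum>l<K. (bc_norm (l22_seq (\<sigma> n) l - w l))\<^sup>2) \<le> \<epsilon>\<^sup>2"
      if N: "\<And>n m. N \<le> n \<Longrightarrow> N \<le> m \<Longrightarrow> l22_norm (\<sigma> n - \<sigma> m) < \<epsilon>" and n: "N \<le> n"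
      for N n K \<epsilon>
    proof (rule LIMSEQ_le_const2)
      show "(\<lambda>m. \<Sum>l<K. (bc_norm (l22_seq (\<sigma> n) l - l22_seq (\<sigma> m) l))\<^sup>2) \<longlonglongrightarrow>
            (\<Sum>l<K. (bc_norm (l22_seq (\<sigma> n) l - w l))\<^sup>2)"
        unfolding bc_norm_square bc_P_simps w by (intro tendsto_intros p q) simp_all
      have "(\<Sum>l<K. (bc_norm (l22_seq (\<sigma> n) l - l22_seq (\<sigma> m) l))\<^sup>2) \<le> \<epsilon>\<^sup>2" if "N \<le> m" for m
      proof -
        have "(\<Sum>l<K. (bc_norm (l22_seq (\<sigma> n) l - l22_seq (\<sigma> m) l))\<^sup>2) \<le> (l22_norm (\<sigma> n - \<sigma> m))\<^sup>2"
          using partial[of "\<sigma> n - \<sigma> m" K] by (simp add: minus_l22.rep_eq)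
        also have "\<dots> \<le> \<epsilon>\<^sup>2"
          using N[OF n that]
          by (intro power_mono) (simp_all add: l22_norm_def suminf_nonneg l22_summable)
        finally show ?thesis .
      qed
      then show "\<exists>N. \<forall>m\<ge>N. (\<Sum>l<K. (bc_norm (l22_seq (\<sigma> n) l - l22_seq (\<sigma> m) l))\<^sup>2) \<le> \<epsilon>\<^sup>2"
        by blast
    qed
    have diff: "summable (\<lambda>l. (bc_norm (l22_seq (\<sigma> n) l - w l))\<^sup>2)"
      "(\<Sum>l. (bc_norm (l22_seq (\<sigma> n) l - w l))\<^sup>2) \<le> \<epsilon>\<^sup>2"
      if "\<And>n m. N \<le> n \<Longrightarrow> N \<le> m \<Longrightarrow> l22_norm (\<sigma> n - \<sigma> m) < \<epsilon>" and "N \<le> n" for N n \<epsilon>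
    proof -
      show s: "summable (\<lambda>l. (bc_norm (l22_seq (\<sigma> n) l - w l))\<^sup>2)"
        by (rule summableI_nonneg_bounded[OF _ lim[OF that]]) simp_all
      show "(\<Sum>l. (bc_norm (l22_seq (\<sigma> n) l - w l))\<^sup>2) \<le> \<epsilon>\<^sup>2"
        by (rule suminf_le_const[OF s lim[OF that]]) simp_all
    qed
    obtain N where N: "\<And>n m. N \<le> n \<Longrightarrow> N \<le> m \<Longrightarrow> l22_norm (\<sigma> n - \<sigma> m) < 1"
      using cauchy[of 1] by auto
    have s: "summable (\<lambda>l. (bc_norm (l22_seq (\<sigma> N) l - w l))\<^sup>2)"
      by (rule diff(1)[OF N order_refl])
    have sw: "summable (\<lambda>l. (bc_norm (w l))\<^sup>2)"
      using summable_cmod_square_diff[OF l22_summable(2)[of "\<sigma> N"],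
          of "\<lambda>l. bc_P1 (l22_seq (\<sigma> N) l) - bc_P1 (w l)"]
        summable_cmod_square_diff[OF l22_summable(3)[of "\<sigma> N"],
          of "\<lambda>l. bc_P2 (l22_seq (\<sigma> N) l) - bc_P2 (w l)"] s
      by (simp add: summable_bc_norm_square_iff)
    have seq: "l22_seq (Abs_l22 w) = w" using sw by (simp add: Abs_l22_inverse)
    have "\<exists>N. \<forall>n\<ge>N. sp_dist l22_sp (\<sigma> n) (Abs_l22 w) < \<epsilon>" if "\<epsilon> > 0" for \<epsilon> :: real
    proof -
      obtain N where N: "\<And>n m. N \<le> n \<Longrightarrow> N \<le> m \<Longrightarrow> l22_norm (\<sigma> n - \<sigma> m) < \<epsilon> / 2"
        using cauchy[of "\<epsilon> / 2"] \<open>\<epsilon> > 0\<close> by auto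
      have "sp_dist l22_sp (\<sigma> n) (Abs_l22 w) < \<epsilon>" if n: "N \<le> n" for n
      proof -
        have "(\<Sum>l. (bc_norm (l22_seq (\<sigma> n) l - w l))\<^sup>2) \<le> (\<epsilon> / 2)\<^sup>2"
          by (rule diff(2)[OF N n])
        then have "l22_norm (\<sigma> n - Abs_l22 w) \<le> sqrt ((\<epsilon> / 2)\<^sup>2)"
          unfolding l22_norm_def minus_l22.rep_eq seq by (rule real_sqrt_le_mono)
        also have "\<dots> < \<epsilon>" using \<open>\<epsilon> > 0\<close> by (simp add: real_sqrt_divide)
        finally show ?thesis by (simp add: sp_dist_def l22_norm_eq_sp_norm)
      qed
      then show ?thesis by blast
    qed
    then have "limitin l22.mtopology \<sigma> (Abs_l22 w) sequentially"
      by (simp add: l22.limit_metric_sequentially)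
    then show "\<exists>x. limitin l22.mtopology \<sigma> x sequentially" by blast
  qed
qed

end

theory Submission
  imports Defs
begin

text \<open>The idempotents split \<open>M\<close> into two complex inner product spaces \<open>e\<^sub>1 M\<close> and \<open>e\<^sub>2 M\<close>, in
  which Gram-Schmidt can be applied to a dense sequence; directly in \<open>M\<close> it fails, because nonzero
  vectors may have a zero divisor as their square. Both components are infinite dimensional, so the
  two orthonormal sequences \<open>u\<close> and \<open>v\<close> are infinite, and \<open>u + v\<close> is a bicomplex orthonormal
  sequence. Its coefficient map is the isometry, onto by completeness of \<open>M\<close>.\<close>

section \<open>Sesquilinearity, orthonormal sequences and Bessel's inequality\<close>

context bicomplex_scalar_product
begin

lemma sp_add_left: "sp (x + y) z = sp x z + sp y z"
  by (rule bc_P_eqI)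
    (simp_all add: sp_cnj[of "x + y" z] sp_cnj[of x z] sp_cnj[of y z] sp_add_right)

lemma sp_scale_left: "sp (scale c x) y = bc_cnj3 c * sp x y"
  by (rule bc_P_eqI) (simp_all add: sp_cnj[of "scale c x" y] sp_cnj[of x y] sp_scale_right)

lemma sp_zero_right [simp]: "sp x 0 = 0"
  using sp_add_right[of x 0 0] by simp

lemma sp_zero_left [simp]: "sp 0 x = 0"
  using sp_add_left[of 0 0 x] by simp

lemma sp_diff_right: "sp x (y - z) = sp x y - sp x z"
  using sp_add_right[of x "y - z" z] by simp

lemma sp_sum_right: "sp x (\<Sum>i\<in>A. f i) = (\<Sum>i\<in>A. sp x (f i))"
  by (induction A rule: infinite_finite_induct) (simp_all add: sp_add_right)

lemma sp_sum_left: "sp (\<Sum>i\<in>A. f i) x = (\<Sum>i\<in>A. sp (f i) x)"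
  by (induction A rule: infinite_finite_induct) (simp_all add: sp_add_left)

lemma sp_eq_0_commute: "sp x y = 0 \<longleftrightarrow> sp y x = 0"
proof -
  have "sp y x = 0" if "sp x y = 0" for x y
    using sp_cnj[of y x] that by (simp add: bc_cnj3_def zero_bicomplex_def)
  then show ?thesis by blast
qed

text \<open>Provides the input of Gram-Schmidt. \<open>from_nat_into\<close> may repeat values, so
  finite and infinite countable sets need no distinction once the set is known to be
  nonempty.\<close>

lemma separable_dense_sequence:
  assumes "separable_space mtopology"
  obtains d :: "nat \<Rightarrow> 'm" where "\<And>x \<epsilon>. 0 < \<epsilon> \<Longrightarrow> \<exists>n. sp_dist sp x (d n) < \<epsilon>"
proof -
  obtain C where C: "countable C" "mtopology closure_of C = UNIV"
    using assms by (auto simp: separable_space_def)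
  have dense: "\<exists>y\<in>C. sp_dist sp x y < \<epsilon>" if "0 < \<epsilon>" for x \<epsilon>
  proof -
    have "x \<in> mtopology closure_of C" by (simp add: C)
    then show ?thesis using that by (auto simp: metric_closure_of in_mball)
  qed
  from dense[of 1] have "C \<noteq> {}" by auto
  with C(1) have "range (from_nat_into C) = C" by (rule range_from_nat_into[rotated])
  then show thesis
    using dense that[of "from_nat_into C"] by (metis rangeE)
qed

text \<open>The value \<open>1\<close> is the bicomplex unit, so both idempotent components of every
  vector are normalised; \<open>sp_norm sp (b n) = 1\<close> would only fix their mean.\<close>

definition bc_orthonormal :: "(nat \<Rightarrow> 'm) \<Rightarrow> bool" where
  "bc_orthonormal b \<longleftrightarrow> (\<forall>m n. sp (b m) (b n) = (if m = n then 1 else 0))"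

lemma sp_orthonormal_sum:
  assumes "bc_orthonormal b" "finite A"
  shows "sp (b n) (\<Sum>l\<in>A. scale (c l) (b l)) = (if n \<in> A then c n else 0)"
  using assms
  by (simp add: sp_sum_right sp_scale_right bc_orthonormal_def if_distrib[of "(*) _"] cong: if_cong)

text \<open>Pythagoras with bicomplex coefficients: orthogonality leaves the products
  \<open>bc_cnj3 (c l) * c l\<close>, and half the real part of the sum of their two idempotent
  components is \<open>(bc_norm (c l))\<^sup>2\<close>.\<close>

lemma rsp_orthonormal_sum:
  assumes "bc_orthonormal b" "finite A"
  shows "rsp (\<Sum>l\<in>A. scale (c l) (b l)) (\<Sum>l\<in>A. scale (c l) (b l)) = (\<Sum>l\<in>A. (bc_norm (c l))\<^sup>2)"
proof -
  have "sp (\<Sum>l\<in>A. scale (c l) (b l)) (\<Sum>l\<in>A. scale (c l) (b l)) = (\<Sum>l\<in>A. bc_cnj3 (c l) * c l)"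
    by (simp add: sp_sum_left sp_scale_left sp_orthonormal_sum[OF assms])
  moreover have "bc_P1 (\<Sum>l\<in>A. f l) = (\<Sum>l\<in>A. bc_P1 (f l))"
    "bc_P2 (\<Sum>l\<in>A. f l) = (\<Sum>l\<in>A. bc_P2 (f l))" for f :: "nat \<Rightarrow> bicomplex"
    by (induction A rule: infinite_finite_induct) simp_all
  moreover have "Re (bc_P1 (bc_cnj3 w * w) + bc_P2 (bc_cnj3 w * w)) / 2 = (bc_norm w)\<^sup>2" for w
    unfolding bc_norm_square cmod_power2 by (simp add: power2_eq_square)
  ultimately show ?thesis
    by (simp add: rsp_def sum_divide_distrib flip: sum.distrib)
qed

text \<open>The projection \<open>s\<close> of \<open>x\<close> is orthogonal to the remainder
  \<open>x - s\<close>, so the square of \<open>s\<close> is at most that of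
  \<open>x\<close>.\<close>

lemma Bessel:
  assumes "bc_orthonormal b" "finite A"
  shows "(\<Sum>l\<in>A. (bc_norm (sp (b l) x))\<^sup>2) \<le> rsp x x"
proof -
  define s where "s = (\<Sum>l\<in>A. scale (sp (b l) x) (b l))"
  have "sp (b l) (x - s) = 0" if "l \<in> A" for l
    using that by (simp add: s_def sp_diff_right sp_orthonormal_sum[OF assms])
  then have "sp s (x - s) = 0"
    by (subst s_def) (simp add: sp_sum_left sp_scale_left)
  then have "rsp s (x - s) = 0" by (simp add: rsp_def)
  then have "rsp ((x - s) + s) ((x - s) + s) = rsp (x - s) (x - s) + rsp s s"
    unfolding rsp_add_left rsp_add_right by (simp add: rsp_sym)
  then have "rsp s s \<le> rsp x x" using rsp_nonneg[of "x - s"] by simp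
  then show ?thesis by (simp add: s_def rsp_orthonormal_sum[OF assms])
qed

text \<open>Bessel for a single index; it makes each coefficient functional continuous, which is
  what passing to limits in the coefficients requires.\<close>

lemma bc_norm_sp_le:
  assumes "bc_orthonormal b"
  shows "bc_norm (sp (b n) x) \<le> sp_norm sp x"
  using Bessel[OF assms, of "{n}" x] by (simp add: sp_norm_eq real_le_rsqrt)

lemma summable_Bessel:
  assumes "bc_orthonormal b"
  shows "summable (\<lambda>l. (bc_norm (sp (b l) x))\<^sup>2)"
  using Bessel[OF assms] by (intro summableI_nonneg_bounded[where x = "rsp x x"]) simp_all

section \<open>Convergence of orthonormal series\<close>

lemma sp_norm_nonneg: "0 \<le> sp_norm sp x"
  by (simp add: sp_norm_eq rsp_nonneg)

lemma sp_norm_square: "(sp_norm sp x)\<^sup>2 = rsp x x"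
  by (simp add: sp_norm_eq rsp_nonneg)

text \<open>Continuity of the norm, by the triangle inequality in both directions.\<close>

lemma limit_of_norm:
  assumes "\<And>\<epsilon>. 0 < \<epsilon> \<Longrightarrow> \<exists>N. \<forall>n\<ge>N. sp_norm sp (\<sigma> n - y) < \<epsilon>"
  shows "(\<lambda>n. sp_norm sp (\<sigma> n)) \<longlonglongrightarrow> sp_norm sp y"
proof (rule LIMSEQ_I)
  have sym: "sp_norm sp (u - v) = sp_norm sp (v - u)" for u v
    using commute[of u v] by (simp add: sp_dist_def)
  fix \<epsilon> :: real assume "0 < \<epsilon>"
  then obtain N where N: "\<And>n. N \<le> n \<Longrightarrow> sp_norm sp (\<sigma> n - y) < \<epsilon>" using assms by blast
  have "norm (sp_norm sp (\<sigma> n) - sp_norm sp y) < \<epsilon>" if "N \<le> n" for n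
    using N[OF that] sp_norm_triangle[of "\<sigma> n - y" y] sp_norm_triangle[of "y - \<sigma> n" "\<sigma> n"]
      sym[of y "\<sigma> n"] by (simp add: abs_less_iff)
  then show "\<exists>N. \<forall>n\<ge>N. norm (sp_norm sp (\<sigma> n) - sp_norm sp y) < \<epsilon>" by blast
qed

end

text \<open>Squared distances of partial sums are blocks of the given convergent series, so
  completeness supplies \<open>y\<close>; continuity of the coefficients and of the norm carries
  both claims to the limit.\<close>

lemma (in bicomplex_hilbert_space) Riesz_Fischer:
  assumes b: "bc_orthonormal b" and s: "summable (\<lambda>l. (bc_norm (w l))\<^sup>2)"
  obtains y where "\<And>n. sp (b n) y = w n" "(sp_norm sp y)\<^sup>2 = (\<Sum>l. (bc_norm (w l))\<^sup>2)"
proof -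
  define S where "S K = (\<Sum>l<K. scale (w l) (b l))" for K
  have diff: "(sp_norm sp (S n - S m))\<^sup>2 = (\<Sum>l=m..<n. (bc_norm (w l))\<^sup>2)" if "m \<le> n" for m n
  proof -
    have "S n - S m = (\<Sum>l=m..<n. scale (w l) (b l))"
      unfolding S_def using that sum_diff_nat_ivl[of 0 m n "\<lambda>l. scale (w l) (b l)"]
      by (simp add: atLeast0LessThan)
    then show ?thesis by (simp add: sp_norm_square rsp_orthonormal_sum[OF b])
  qed
  have "MCauchy S"
    unfolding MCauchy_def
  proof (intro conjI allI impI)
    fix \<epsilon> :: real assume \<epsilon>: "0 < \<epsilon>"
    from s[unfolded summable_Cauchy, rule_format, of "\<epsilon>\<^sup>2"] \<epsilon>
    obtain N where N: "\<And>m n. N \<le> m \<Longrightarrow> norm (\<Sum>l=m..<n. (bc_norm (w l))\<^sup>2) < \<epsilon>\<^sup>2"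
      by auto
    have *: "sp_dist sp (S n) (S m) < \<epsilon>" if "N \<le> m" "m \<le> n" for m n
    proof -
      have "(sp_norm sp (S n - S m))\<^sup>2 < \<epsilon>\<^sup>2" using N[OF that(1), of n] by (simp add: diff[OF that(2)])
      then show ?thesis using \<epsilon> by (simp add: sp_dist_def power2_less_imp_less)
    qed
    have "sp_dist sp (S n) (S m) < \<epsilon>" if "N \<le> m" "N \<le> n" for m n
      using *[of m n] *[of n m] that commute[of "S n" "S m"] by (cases "m \<le> n") auto
    then show "\<exists>N. \<forall>n n'. N \<le> n \<longrightarrow> N \<le> n' \<longrightarrow> sp_dist sp (S n) (S n') < \<epsilon>" by blast
  qed simp
  then obtain y where "limitin mtopology S y sequentially"
    using complete by (auto simp: mcomplete_def)
  then have lim: "\<exists>N. \<forall>n\<ge>N. sp_norm sp (S n - y) < \<epsilon>" if "0 < \<epsilon>" for \<epsilon>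
    using that by (auto simp: limit_metric_sequentially sp_dist_def)
  have "sp (b n) y = w n" for n
  proof -
    have small: "bc_norm (sp (b n) y - w n) < \<epsilon>" if \<epsilon>: "0 < \<epsilon>" for \<epsilon>
    proof -
      obtain N where N: "\<And>k. N \<le> k \<Longrightarrow> sp_norm sp (S k - y) < \<epsilon>" using lim[OF \<epsilon>] by blast
      \<comment> \<open>\<open>S k\<close> sums over \<open>l < k\<close>, so \<open>k\<close> must
        exceed \<open>n\<close> for the coefficient at \<open>n\<close> to have reached its final
        value \<open>w n\<close>.\<close>
      define k where "k = max N (Suc n)"
      have "sp (b n) (S k) = w n"
        by (simp add: S_def sp_orthonormal_sum[OF b] k_def)
      then have "sp (b n) (y - S k) = sp (b n) y - w n" by (simp add: sp_diff_right)
      then have "bc_norm (sp (b n) y - w n) \<le> sp_norm sp (y - S k)"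
        using bc_norm_sp_le[OF b, of n "y - S k"] by simp
      also have "\<dots> = sp_norm sp (S k - y)" using commute[of y "S k"] by (simp add: sp_dist_def)
      also have "\<dots> < \<epsilon>" by (rule N) (simp add: k_def)
      finally show ?thesis .
    qed
    have "bc_norm (sp (b n) y - w n) = 0"
      using small[of "bc_norm (sp (b n) y - w n)"] bc_norm_nonneg[of "sp (b n) y - w n"] by linarith
    then have "(bc_norm (sp (b n) y - w n))\<^sup>2 = 0" by simp
    then show ?thesis
      unfolding bc_norm_square by (intro bc_P_eqI) (simp_all add: add_nonneg_eq_0_iff)
  qed
  moreover have "(sp_norm sp y)\<^sup>2 = (\<Sum>l. (bc_norm (w l))\<^sup>2)"
  proof (rule LIMSEQ_unique)
    show "(\<lambda>n. (sp_norm sp (S n))\<^sup>2) \<longlonglongrightarrow> (sp_norm sp y)\<^sup>2"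
      by (intro tendsto_power limit_of_norm lim)
    have "(sp_norm sp (S n))\<^sup>2 = (\<Sum>l<n. (bc_norm (w l))\<^sup>2)" for n
      by (simp add: S_def sp_norm_square rsp_orthonormal_sum[OF b])
    then show "(\<lambda>n. (sp_norm sp (S n))\<^sup>2) \<longlonglongrightarrow> (\<Sum>l. (bc_norm (w l))\<^sup>2)"
      using summable_LIMSEQ[OF s] by simp
  qed
  ultimately show thesis by (rule that)
qed

section \<open>One idempotent component, treated for both choices at once\<close>

locale bicomplex_component = bicomplex_scalar_product scale sp
  for scale :: "bicomplex \<Rightarrow> 'm::ab_group_add \<Rightarrow> 'm" and sp +
  fixes P :: "bicomplex \<Rightarrow> complex" and e :: bicomplex
  assumes component: "P = bc_P1 \<and> e = bc_e1 \<or> P = bc_P2 \<and> e = bc_e2"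
begin

lemma P_simps [simp]:
  "P 0 = 0" "P (v + w) = P v + P w" "P (v - w) = P v - P w" "P (v * w) = P v * P w"
  "P (bc_of_complex z) = z" "P e = 1" "P (bc_cnj3 w) = cnj (P w)"
  using component by auto

lemma P_sum: "P (\<Sum>i\<in>A. f i) = (\<Sum>i\<in>A. P (f i))"
  by (induction A rule: infinite_finite_induct) simp_all

text \<open>On multiples of \<open>e\<close> a bicomplex scalar acts as the complex number
  \<open>P w\<close>; this makes the component a complex space.\<close>

lemma e_mult: "e * w = bc_of_complex (P w) * e"
  using component by (auto intro: bc_P_eqI)

lemma e_idem: "e * (e * c) = e * c"
  using component by (auto intro: bc_P_eqI)

text \<open>Defined on the whole module, so that no type for the component is needed. The form is
  only semidefinite there: its null vectors are those killed by \<open>e\<close>, as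
  \<open>h_self_eq_0_iff\<close> shows.\<close>

definition h :: "'m \<Rightarrow> 'm \<Rightarrow> complex" where
  "h x y = P (sp x y)"

lemma h_diff_right: "h x (y - z) = h x y - h x z"
  by (simp add: h_def sp_diff_right)

lemma h_scale_right: "h x (scale c y) = P c * h x y"
  by (simp add: h_def sp_scale_right)

lemma h_scale_left: "h (scale c x) y = cnj (P c) * h x y"
  by (simp add: h_def sp_scale_left)

lemma h_sum_right: "h x (\<Sum>i\<in>A. f i) = (\<Sum>i\<in>A. h x (f i))"
  by (simp add: h_def sp_sum_right P_sum)

lemma h_cnj: "h x y = cnj (h y x)"
  by (subst h_def, subst sp_cnj) (simp add: h_def)

lemma h_self: "h x x = of_real (Re (h x x))" "0 \<le> Re (h x x)"
  using sp_positive[of x] component by (auto simp: h_def bc_D_plus_iff complex_eq_iff)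

lemma sp_scale_e: "sp x (scale e y) = bc_of_complex (h x y) * e"
  by (simp add: sp_scale_right e_mult h_def)

text \<open>Definiteness of \<open>sp\<close> is applied to \<open>scale e x\<close>, whose square
  is \<open>h x x\<close> times \<open>e\<close>.\<close>

lemma h_self_eq_0_iff: "h x x = 0 \<longleftrightarrow> scale e x = 0"
proof -
  have "sp (scale e x) (scale e x) = bc_of_complex (h x x) * e"
    unfolding sp_scale_e h_scale_left by simp
  then have "scale e x = 0 \<longleftrightarrow> bc_of_complex (h x x) * e = 0" by (metis sp_definite)
  also have "\<dots> \<longleftrightarrow> h x x = 0"
  proof
    assume "bc_of_complex (h x x) * e = 0"
    then have "P (bc_of_complex (h x x) * e) = 0" by (simp del: P_simps(4-))
    then show "h x x = 0" by simp
  next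
    assume "h x x = 0"
    then show "bc_of_complex (h x x) * e = 0"
      by (intro bc_P_eqI) simp_all
  qed
  finally show ?thesis by blast
qed

section \<open>Gram-Schmidt for the semidefinite form\<close>

lemma h_null_left:
  assumes "h x x = 0"
  shows "h x y = 0"
proof -
  \<comment> \<open>Since \<open>P e = 1\<close>, the form does not distinguish \<open>x\<close>
    from \<open>scale e x\<close>, which is zero here.\<close>
  have "h (scale e x) y = 0"
    using assms[unfolded h_self_eq_0_iff] by (simp add: h_def)
  then show ?thesis by (simp add: h_scale_left)
qed

text \<open>If \<open>gram_schmidt d k\<close> is null for \<open>h\<close>, the coefficient is \<open>0 / 0 = 0\<close>; such vectors are
  kept here and discarded in \<open>orthonormal_total_sequence\<close>.\<close>

fun gram_schmidt :: "(nat \<Rightarrow> 'm) \<Rightarrow> nat \<Rightarrow> 'm" where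
  "gram_schmidt d n = d n - (\<Sum>k<n. scale (bc_of_complex
     (h (gram_schmidt d k) (d n) / h (gram_schmidt d k) (gram_schmidt d k))) (gram_schmidt d k))"

declare gram_schmidt.simps [simp del]

text \<open>Strong induction on the larger index: the earlier vectors are pairwise orthogonal, so
  only the term \<open>k = m\<close> of the subtracted sum survives, and it cancels
  \<open>h (?r m) (d n)\<close>.\<close>

lemma gram_schmidt_orthogonal_less:
  "m < n \<Longrightarrow> h (gram_schmidt d m) (gram_schmidt d n) = 0"
proof (induction n arbitrary: m rule: less_induct)
  case (less n)
  let ?r = "gram_schmidt d"
  have orth: "h (?r m) (?r k) = 0" if "k < n" "k \<noteq> m" for k
    using less.IH[of k m] less.IH[of m k] less.prems that h_cnj[of "?r m" "?r k"]
    by (cases "m < k") auto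
  have "h (?r m) (?r n)
      = h (?r m) (d n) - (\<Sum>k<n. h (?r k) (d n) / h (?r k) (?r k) * h (?r m) (?r k))"
    by (subst (2) gram_schmidt.simps) (simp add: h_diff_right h_sum_right h_scale_right)
  also have "(\<Sum>k<n. h (?r k) (d n) / h (?r k) (?r k) * h (?r m) (?r k))
      = (\<Sum>k<n. if k = m then h (?r m) (d n) / h (?r m) (?r m) * h (?r m) (?r m) else 0)"
    using orth by (intro sum.cong) auto
  \<comment> \<open>For a null \<open>?r m\<close> both sides are zero, the right one by
    \<open>h_null_left\<close>.\<close>
  also have "\<dots> = h (?r m) (d n)"
    using less.prems h_null_left[of "?r m"] by (simp add: sum.delta)
  finally show ?case by simp
qed

lemma gram_schmidt_orthogonal:
  "m \<noteq> n \<Longrightarrow> h (gram_schmidt d m) (gram_schmidt d n) = 0"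
  using gram_schmidt_orthogonal_less[of m n d] gram_schmidt_orthogonal_less[of n m d]
    h_cnj[of "gram_schmidt d m" "gram_schmidt d n"]
  by (cases "m < n") auto

text \<open>Orthogonality to all Gram-Schmidt vectors passes to all \<open>d n\<close>, and a vector
  orthogonal to a dense sequence is zero.\<close>

lemma gram_schmidt_total:
  assumes dense: "\<And>x \<epsilon>. 0 < \<epsilon> \<Longrightarrow> \<exists>n. sp_dist sp x (d n) < \<epsilon>"
    and orth: "\<And>n. h (gram_schmidt d n) x = 0"
  shows "h x x = 0"
proof -
  \<comment> \<open>Multiplying by \<open>e\<close> removes the other component, so
    \<open>h x (d n) = 0\<close> becomes orthogonality of \<open>z\<close> and \<open>d n\<close>
    for the full product \<open>sp\<close>.\<close>
  define z where "z = scale e x"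
  have rx: "h x (gram_schmidt d n) = 0" for n
    using orth[of n] h_cnj[of x "gram_schmidt d n"] by simp
  have "d n = gram_schmidt d n + (\<Sum>k<n. scale (bc_of_complex
     (h (gram_schmidt d k) (d n) / h (gram_schmidt d k) (gram_schmidt d k))) (gram_schmidt d k))" for n
    by (subst gram_schmidt.simps) simp
  then have "h x (d n) = h x (gram_schmidt d n) + h x (\<Sum>k<n. scale (bc_of_complex
     (h (gram_schmidt d k) (d n) / h (gram_schmidt d k) (gram_schmidt d k))) (gram_schmidt d k))" for n
    by (metis h_def sp_add_right P_simps(2))
  then have "h x (d n) = 0" for n
    by (simp add: h_sum_right h_scale_right rx)
  then have "sp (d n) z = 0" for n
    using h_cnj[of "d n" x] unfolding z_def sp_scale_e by (intro bc_P_eqI) simp_all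
  then have dz: "rsp (d n) z = 0" "rsp z (d n) = 0" for n
    using sp_eq_0_commute[of "d n" z] by (simp_all add: rsp_def)
  \<comment> \<open>By Pythagoras no \<open>d n\<close> is closer to \<open>z\<close> than the
    origin is, which contradicts density unless \<open>z\<close> is zero.\<close>
  have far: "rsp z z \<le> (sp_dist sp z (d n))\<^sup>2" for n
  proof -
    have "rsp (z + - d n) (z + - d n) = rsp z z + rsp (d n) (d n)"
      unfolding rsp_add_left rsp_add_right rsp_minus_left rsp_minus_right by (simp add: dz)
    then show ?thesis
      using rsp_nonneg[of "d n"] by (simp add: sp_dist_def sp_norm_square)
  qed
  have "rsp z z = 0"
  proof (rule ccontr)
    assume "rsp z z \<noteq> 0"
    then have pos: "0 < sp_norm sp z" using rsp_nonneg[of z] by (simp add: sp_norm_eq)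
    then obtain n where "sp_dist sp z (d n) < sp_norm sp z" using dense by blast
    then have "(sp_dist sp z (d n))\<^sup>2 < (sp_norm sp z)\<^sup>2"
      by (intro power_strict_mono) simp_all
    then show False using far[of n] by (simp add: sp_norm_square)
  qed
  then show ?thesis by (simp add: rsp_eq_0_iff h_self_eq_0_iff z_def)
qed

section \<open>Infinite dimension of a component and its orthonormal sequence\<close>

lemma component_vector_space: "vector_space (\<lambda>a x. scale (bc_of_complex a) x)"
proof
  have hom: "bc_of_complex (a + b) = bc_of_complex a + bc_of_complex b"
    "bc_of_complex (a * b) = bc_of_complex a * bc_of_complex b" "bc_of_complex 1 = 1" for a b
    by (auto intro: bc_P_eqI)
  fix a b :: complex and x y :: 'm
  show "scale (bc_of_complex a) (x + y) = scale (bc_of_complex a) x + scale (bc_of_complex a) y"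
    by (rule scale_right_distrib)
  show "scale (bc_of_complex (a + b)) x = scale (bc_of_complex a) x + scale (bc_of_complex b) x"
    by (simp add: hom scale_left_distrib)
  show "scale (bc_of_complex a) (scale (bc_of_complex b) x) = scale (bc_of_complex (a * b)) x"
    by (simp add: hom)
  show "scale (bc_of_complex 1) x = x" by (simp add: hom)
qed

text \<open>Multiplication by \<open>e\<close> keeps \<open>M(2)\<close>-independent vectors independent over the complex numbers,
  since \<open>bc_of_complex a * e = 0\<close> forces \<open>a = 0\<close>; so a finite orthogonal system spanning the
  component contradicts infinite dimension.\<close>

lemma infinite_nonnull_orthogonal:
  fixes r :: "nat \<Rightarrow> 'm"
  assumes infinite_dim: "\<And>n::nat. \<exists>B. finite B \<and> card B = n \<and> \<not> dependent B"
    and orth: "\<And>m n. m \<noteq> n \<Longrightarrow> h (r m) (r n) = 0"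
    and total: "\<And>x. (\<And>n. h (r n) x = 0) \<Longrightarrow> h x x = 0"
  shows "infinite {n. h (r n) (r n) \<noteq> 0}"
proof
  define I where "I = {n. h (r n) (r n) \<noteq> 0}"
  assume "finite {n. h (r n) (r n) \<noteq> 0}"
  then have fin: "finite I" by (simp add: I_def)
  interpret C: vector_space "\<lambda>a x. scale (bc_of_complex a) x" by (rule component_vector_space)
  define R where "R = (\<lambda>k. scale e (r k)) ` I"
  obtain B where B: "finite B" "card B = Suc (card I)" "\<not> dependent B"
    using infinite_dim by blast
  have coeff: "u b = 0" if "(\<Sum>b\<in>B. scale (bc_of_complex (u b) * e) b) = 0" "b \<in> B" for u b
  proof -
    have "bc_of_complex (u b) * e = 0"
      using B that by (auto simp: dependent_finite)
    then have "P (bc_of_complex (u b) * e) = 0" by (simp del: P_simps(4-))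
    then show ?thesis by simp
  qed
  \<comment> \<open>Ensures that \<open>scale e\<close> does not shrink \<open>B\<close>: a
    collision would be a relation with coefficients \<open>1\<close> and \<open>- 1\<close>.\<close>
  have inj: "inj_on (scale e) B"
  proof (rule inj_onI, rule ccontr)
    fix a b assume ab: "a \<in> B" "b \<in> B" "scale e a = scale e b" "a \<noteq> b"
    define u :: "'m \<Rightarrow> complex" where "u x = (if x = a then 1 else if x = b then - 1 else 0)" for x
    have one: "bc_of_complex 1 * e = e" "bc_of_complex (- 1) * e = - e" "bc_of_complex 0 * e = 0"
      by (auto intro: bc_P_eqI)
    have "(\<Sum>x\<in>B. scale (bc_of_complex (u x) * e) x)
        = (\<Sum>x\<in>{a, b}. scale (bc_of_complex (u x) * e) x)"
      using ab B by (intro sum.mono_neutral_right) (auto simp: u_def one)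
    also have "\<dots> = 0" using ab by (simp add: u_def one)
    finally have "u a = 0" using coeff[of u a] ab(1) by blast
    then show False by (simp add: u_def)
  qed
  have "C.independent (scale e ` B)"
  proof
    assume "C.dependent (scale e ` B)"
    then obtain u b where u: "b \<in> B" "u (scale e b) \<noteq> 0"
      "(\<Sum>v\<in>scale e ` B. scale (bc_of_complex (u v)) v) = 0"
      using B by (auto simp: C.dependent_finite)
    then have "(\<Sum>x\<in>B. scale (bc_of_complex (u (scale e x)) * e) x) = 0"
      by (simp add: sum.reindex[OF inj])
    from coeff[OF this u(1)] u(2) show False by simp
  qed
  moreover have "scale e x \<in> C.span R" for x
  proof -
    \<comment> \<open>The \<open>h\<close>-projection of \<open>x\<close>, placed inside the
      component by the factor \<open>e\<close>. The remainder \<open>x - s\<close> is null by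
      totality, so \<open>e\<close> maps \<open>x\<close> to \<open>s\<close>.\<close>
    define s where "s = (\<Sum>k\<in>I. scale (bc_of_complex (h (r k) x / h (r k) (r k))) (scale e (r k)))"
    have sR: "s \<in> C.span R"
      unfolding s_def by (intro C.span_sum C.span_scale C.span_base) (auto simp: R_def)
    have es: "scale e s = s"
      unfolding s_def scale_sum_right by (intro sum.cong refl) (simp add: e_idem mult.commute[of _ e])
    have "h (r n) (x - s) = 0" for n
    proof (cases "n \<in> I")
      case True
      have "h (r n) s = (\<Sum>k\<in>I. h (r k) x / h (r k) (r k) * h (r n) (r k))"
        by (simp add: s_def h_sum_right h_scale_right)
      also have "\<dots> = (\<Sum>k\<in>I. if k = n then h (r n) x else 0)"
        using orth True by (intro sum.cong) (auto simp: I_def)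
      also have "\<dots> = h (r n) x" using True fin by simp
      finally show ?thesis by (simp add: h_diff_right)
    next
      case False
      then show ?thesis by (simp add: I_def h_null_left)
    qed
    then have "h (x - s) (x - s) = 0" by (rule total)
    then have "scale e x = s" by (simp add: h_self_eq_0_iff scale_right_diff_distrib es)
    then show ?thesis using sR by simp
  qed
  then have "scale e ` B \<subseteq> C.span R" by blast
  moreover have "finite R" using fin by (simp add: R_def)
  \<comment> \<open>The exchange bound: \<open>card I + 1\<close> independent vectors cannot lie in
    the span of at most \<open>card I\<close> vectors.\<close>
  ultimately have "card (scale e ` B) \<le> card R"
    using C.independent_span_bound by blast
  also have "card R \<le> card I"
    unfolding R_def using fin by (rule card_image_le)
  finally show False
    using B(2) card_image[OF inj] by linarith
qed

text \<open>The nonnull Gram-Schmidt vectors are renumbered and normalised. Discarding the null ones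
  keeps totality, since by \<open>h_null_left\<close> they are orthogonal to everything.\<close>

lemma orthonormal_total_sequence:
  assumes infinite_dim: "\<And>n::nat. \<exists>B. finite B \<and> card B = n \<and> \<not> dependent B"
    and separable: "separable_space mtopology"
  shows "\<exists>u :: nat \<Rightarrow> 'm. (\<forall>m n. h (u m) (u n) = (if m = n then 1 else 0)) \<and>
    (\<forall>n. scale e (u n) = u n) \<and> (\<forall>x. (\<forall>n. h (u n) x = 0) \<longrightarrow> h x x = 0)"
proof -
  obtain d :: "nat \<Rightarrow> 'm" where d: "\<And>x \<epsilon>. 0 < \<epsilon> \<Longrightarrow> \<exists>n. sp_dist sp x (d n) < \<epsilon>"
    using separable_dense_sequence[OF separable] by blast
  define r where "r = gram_schmidt d"
  have orth: "h (r m) (r n) = 0" if "m \<noteq> n" for m n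
    using gram_schmidt_orthogonal[OF that] by (simp add: r_def)
  have total: "h x x = 0" if "\<And>n. h (r n) x = 0" for x
    using gram_schmidt_total[OF d] that by (simp add: r_def)
  define I where "I = {n. h (r n) (r n) \<noteq> 0}"
  have inf: "infinite I"
    unfolding I_def by (rule infinite_nonnull_orthogonal[OF infinite_dim]) (fact orth, fact total)
  define a :: "nat \<Rightarrow> complex" where "a k = of_real (1 / sqrt (Re (h (r k) (r k))))" for k
  define f where "f = enumerate I"
  \<comment> \<open>The factor \<open>e\<close> moves the vector into the component without changing
    its products under \<open>h\<close>.\<close>
  define u where "u n = scale (bc_of_complex (a (f n)) * e) (r (f n))" for n
  have f: "f n \<in> I" "f m = f n \<longleftrightarrow> m = n" for m n
    using enumerate_in_set[OF inf] inj_enumerate[OF inf] by (auto simp: f_def inj_on_def)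
  have a: "cnj (a k) * (a k * h (r k) (r k)) = 1" "a k \<noteq> 0" if "k \<in> I" for k
  proof -
    define t where "t = Re (h (r k) (r k))"
    have t: "h (r k) (r k) = of_real t" "0 < t"
      using that h_self[of "r k"] by (auto simp: t_def I_def less_le)
    then have "1 / sqrt t * (1 / sqrt t * t) = 1" by (simp add: field_simps)
    then have "of_real (1 / sqrt t * (1 / sqrt t * t)) = (1 :: complex)" by (simp only: of_real_1)
    then show "cnj (a k) * (a k * h (r k) (r k)) = 1"
      unfolding a_def t(1) Re_complex_of_real complex_cnj_complex_of_real of_real_mult .
    then show "a k \<noteq> 0" by auto
  qed
  have hu: "h (u n) x = cnj (a (f n)) * h (r (f n)) x" for n x
    by (simp add: u_def h_scale_left)
  show ?thesis
  proof (intro exI conjI allI impI)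
    show "h (u m) (u n) = (if m = n then 1 else 0)" for m n
    proof (cases "m = n")
      case True
      then show ?thesis
        using a(1)[OF f(1), of n] by (simp add: hu) (simp add: u_def h_scale_right)
    next
      case False
      then show ?thesis
        using orth f(2) by (simp add: hu) (simp add: u_def h_scale_right)
    qed
    show "scale e (u n) = u n" for n
      by (simp add: u_def e_idem mult.commute[of _ e])
    show "h x x = 0" if x: "\<forall>n. h (u n) x = 0" for x
    proof (rule total)
      fix k
      show "h (r k) x = 0"
      proof (cases "k \<in> I")
        case True
        then obtain n where "f n = k"
          using enumerate_Ex[of I k] inf by (auto simp: f_def)
        then show ?thesis using x[rule_format, of n] a(2)[OF True] by (simp add: hu)
      next
        case False
        then show ?thesis by (simp add: I_def h_null_left)
      qed
    qed
  qed
qed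

end

section \<open>Joining the two components\<close>

lemma (in bicomplex_scalar_product) bicomplex_orthonormal_basis:
  assumes infinite_dim: "\<And>n::nat. \<exists>B. finite B \<and> card B = n \<and> \<not> dependent B"
    and separable: "separable_space mtopology"
  obtains b where "bc_orthonormal b" "\<And>x. (\<And>n. sp (b n) x = 0) \<Longrightarrow> x = 0"
proof -
  interpret C1: bicomplex_component scale sp bc_P1 bc_e1 by unfold_locales simp
  interpret C2: bicomplex_component scale sp bc_P2 bc_e2 by unfold_locales simp
  obtain u :: "nat \<Rightarrow> 'm" where u: "\<forall>m n. C1.h (u m) (u n) = (if m = n then 1 else 0)"
    "\<forall>n. scale bc_e1 (u n) = u n" "\<forall>x. (\<forall>n. C1.h (u n) x = 0) \<longrightarrow> C1.h x x = 0"
    using C1.orthonormal_total_sequence[OF infinite_dim separable] by (elim exE conjE)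
  obtain v :: "nat \<Rightarrow> 'm" where v: "\<forall>m n. C2.h (v m) (v n) = (if m = n then 1 else 0)"
    "\<forall>n. scale bc_e2 (v n) = v n" "\<forall>x. (\<forall>n. C2.h (v n) x = 0) \<longrightarrow> C2.h x x = 0"
    using C2.orthonormal_total_sequence[OF infinite_dim separable] by (elim exE conjE)
  note u = u[rule_format] and v = v[rule_format]
  \<comment> \<open>As a multiple of \<open>bc_e1\<close>, the vector \<open>u n\<close> has
    products whose second component vanishes; symmetrically for \<open>v n\<close>.\<close>
  have u2: "bc_P2 (sp (u n) x) = 0" for n x
    by (subst u(2)[symmetric]) (simp add: sp_scale_left)
  have v1: "bc_P1 (sp (v n) x) = 0" for n x
    by (subst v(2)[symmetric]) (simp add: sp_scale_left)
  have u2': "bc_P2 (sp x (u n)) = 0" and v1': "bc_P1 (sp x (v n)) = 0" for n x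
    by (subst sp_cnj, simp add: u2 v1)+
  \<comment> \<open>Cross terms vanish, so \<open>bc_P1\<close> of a product with \<open>b n\<close>
    comes from \<open>u n\<close> alone and \<open>bc_P2\<close> from \<open>v n\<close> alone;
    orthonormality and totality can be checked componentwise.\<close>
  define b where "b n = u n + v n" for n
  have "bc_orthonormal b"
    unfolding bc_orthonormal_def b_def
    using u(1)[unfolded C1.h_def] v(1)[unfolded C2.h_def]
    by (auto intro!: bc_P_eqI simp: sp_add_left sp_add_right u2 v1 u2' v1')
  moreover have "x = 0" if x: "\<And>n. sp (b n) x = 0" for x
  proof -
    have "bc_P1 (sp (b n) x) = 0" "bc_P2 (sp (b n) x) = 0" for n by (simp_all add: x)
    then have uv: "C1.h (u n) x = 0" "C2.h (v n) x = 0" for n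
      by (simp_all add: b_def sp_add_left C1.h_def C2.h_def u2 v1)
    have "C1.h x x = 0" by (rule u(3)) (rule uv)
    moreover have "C2.h x x = 0" by (rule v(3)) (rule uv)
    ultimately have "sp x x = 0" by (intro bc_P_eqI) (simp_all add: C1.h_def C2.h_def)
    then show ?thesis by (simp add: sp_definite)
  qed
  ultimately show thesis by (rule that)
qed

section \<open>The coefficient map as an isometric isomorphism\<close>

theorem theorem3p11:
  fixes scale :: "bicomplex \<Rightarrow> 'm::ab_group_add \<Rightarrow> 'm"
    and sp :: "'m \<Rightarrow> 'm \<Rightarrow> bicomplex"
  assumes hilbert: "bicomplex_hilbert_space scale sp"
    and infinite_dim: "\<And>n::nat. \<exists>B. finite B \<and> card B = n \<and> \<not> module.dependent scale B"
    and separable: "separable_space (Metric_space.mtopology UNIV (sp_dist sp))"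
  shows "\<exists>T :: 'm \<Rightarrow> l22. bij T \<and> module_hom scale l22_scale T \<and>
           (\<forall>\<phi>. l22_norm (T \<phi>) = sp_norm sp \<phi>)"
proof -
  interpret bicomplex_hilbert_space scale sp by (rule hilbert)
  obtain b where b: "bc_orthonormal b" and total: "\<And>x. (\<And>n. sp (b n) x = 0) \<Longrightarrow> x = 0"
    using bicomplex_orthonormal_basis[OF infinite_dim separable] by blast
  have unique: "x = y" if "\<And>n. sp (b n) x = sp (b n) y" for x y
    using total[of "x - y"] that by (simp add: sp_diff_right)
  define T where "T x = Abs_l22 (\<lambda>n. sp (b n) x)" for x
  have T: "l22_seq (T x) = (\<lambda>n. sp (b n) x)" for x
    using summable_Bessel[OF b] by (simp add: T_def Abs_l22_inverse)
  have "bij T"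
  proof (rule bijI)
    show "inj T"
      by (rule injI, rule unique) (metis T)
    show "surj T"
      unfolding surj_def
    proof
      fix w
      obtain y where "\<And>n. sp (b n) y = l22_seq w n"
        using Riesz_Fischer[OF b l22_summable(1)] by blast
      then have "l22_seq w = l22_seq (T y)" by (simp add: T)
      then show "\<exists>y. w = T y" by (auto simp: l22_seq_inject)
    qed
  qed
  moreover have "module_hom scale l22_scale T"
  proof
    show "T (x + y) = T x + T y" for x y
      by (rule l22_seq_inject[THEN iffD1]) (simp add: T plus_l22.rep_eq sp_add_right)
    show "T (scale c x) = l22_scale c (T x)" for c x
      by (rule l22_seq_inject[THEN iffD1]) (simp add: T l22_scale.rep_eq sp_scale_right)
  qed
  moreover have "l22_norm (T x) = sp_norm sp x" for x
  proof -
    \<comment> \<open>Riesz-Fischer for the coefficients of \<open>x\<close> itself returns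
      \<open>x\<close> by uniqueness, and its norm clause becomes Parseval's identity.\<close>
    obtain y where y: "\<And>n. sp (b n) y = sp (b n) x"
      "(sp_norm sp y)\<^sup>2 = (\<Sum>l. (bc_norm (sp (b l) x))\<^sup>2)"
      using Riesz_Fischer[OF b summable_Bessel[OF b]] by blast
    from y(1) have "y = x" by (rule unique)
    with y(2) show ?thesis
      by (simp add: l22_norm_def T sp_norm_nonneg flip: y(2))
  qed
  ultimately show ?thesis by blast
qed

end
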